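(* For every integer $r \ge 2$ there exists a 2-connected graph $G$ of order divisible by $r$ such that $G^{r-1}$ does not contain a $K_r$-factor.
   Context: Graphs are finite, and the order of a graph is its number of vertices. For a graph $G$ and $k \ge 1$, the $k$th power $G^k$ is the graph with the same vertex set as $G$ in which two distinct vertices are adjacent if and only if there is a path between them in $G$ of length at most $k$. A $K_r$-factor in a graph is a spanning subgraph in which every connected component is isomorphic to the complete graph $K_r$ on $r$ vertices. *)

theory Defs
  imports "Graph_Theory.Graph_Theory"
begin

text \<open>
  Finite simple graphs are the instances of \<^locale>\<open>pair_graph\<close>: finite, loop-free digraphs without
  parallel arcs whose arc set is symmetric, so an undirected edge is a pair of opposite arcs.
\<close>

text \<open>As usual, a \<open>k\<close>-connected graph has more than \<open>k\<close> vertices; in particular the complete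
  graph on two vertices is not 2-connected.\<close>

definition k_connected :: "nat \<Rightarrow> 'a pair_pre_digraph \<Rightarrow> bool" where
  "k_connected k G \<longleftrightarrow>
     k < card (pverts G) \<and>
     (\<forall>X. X \<subseteq> pverts G \<and> card X < k \<longrightarrow> connected (with_proj G \<restriction> (pverts G - X)))"

definition graph_power :: "'a pair_pre_digraph \<Rightarrow> nat \<Rightarrow> 'a pair_pre_digraph" where
  "graph_power G k =
     \<lparr> pverts = pverts G,
       parcs = {(u, v). u \<in> pverts G \<and> v \<in> pverts G \<and> u \<noteq> v \<and>
                  (\<exists>p. pre_digraph.apath (with_proj G) u p v \<and> length p \<le> k)} \<rparr>"

text \<open>The requirement \<^term>\<open>pair_graph H\<close> makes \<open>H\<close> an undirected subgraph; its connected components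
  are then its strongly connected components.\<close>

definition is_complete_factor :: "nat \<Rightarrow> 'a pair_pre_digraph \<Rightarrow> 'a pair_pre_digraph \<Rightarrow> bool" where
  "is_complete_factor r H G \<longleftrightarrow>
     pair_graph H \<and> spanning (with_proj H) (with_proj G) \<and>
     (\<forall>C \<in> pre_digraph.sccs (with_proj H). complete_digraph r C)"

end

theory Submission
  imports Defs
begin

text \<open>
  Take a cubic graph on \<open>2r\<close> hubs and replace each of its \<open>3r\<close> edges by a path with \<open>r - 1\<close>
  interior vertices; the order is \<open>2r + 3r(r - 1) = r(3r - 1)\<close>. No \<open>r\<close>-clique of the
  \<open>(r - 1)\<close>th power fits into the interior of one path, so each such clique passes over a hub. Two
  cliques at the same hub intersect: if a clique reaches depths \<open>p\<^sub>1, p\<^sub>2, p\<^sub>3\<close> into the three paths at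
  the hub, then \<open>p\<^sub>i + p\<^sub>j \<le> r - 1\<close> for \<open>i \<noteq> j\<close>, which leaves room for at most
  \<open>1 + 2(r - 1) < 2r\<close> vertices in the union of two cliques. Hence there are at most \<open>2r\<close> disjoint
  cliques, whereas a factor needs \<open>3r - 1\<close>. The cubic graph used here is the Moebius ladder: a
  Hamiltonian cycle through all hubs together with its long diagonals.
\<close>

locale subdivided_moebius_ladder =
  fixes r :: nat
  assumes r_ge_2: "2 \<le> r"
begin

text \<open>
  Edges \<open>e < 2r\<close> of the ladder form the cycle, the others are the diagonals. Hub \<open>i\<close> is the
  number \<open>i * r\<close>, and \<open>pt e k\<close> is the \<open>k\<close>th of the \<open>r + 1\<close> points on the path replacing edge \<open>e\<close>. As the
  path of a cycle edge \<open>e\<close> starts at \<open>e * r\<close>, the subdivided cycle is \<open>0, 1, \<dots>, 2r\<^sup>2 - 1\<close>; the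
  multiples of \<open>r\<close> above it are not vertices.
\<close>

definition src :: "nat \<Rightarrow> nat" where
  "src e = (if e < 2 * r then e else e - 2 * r)"

definition tgt :: "nat \<Rightarrow> nat" where
  "tgt e = (if e < 2 * r then if Suc e = 2 * r then 0 else Suc e else e - r)"

definition pt :: "nat \<Rightarrow> nat \<Rightarrow> nat" where
  "pt e k = (if k = 0 then src e * r else if k = r then tgt e * r else e * r + k)"

definition vs :: "nat set" where
  "vs = {..<3 * r * r} - (\<lambda>e. e * r) ` {2 * r..<3 * r}"

definition adj :: "nat \<Rightarrow> nat \<Rightarrow> bool" where
  "adj u v \<longleftrightarrow> (\<exists>e k. e < 3 * r \<and> k < r \<and>
     (u = pt e k \<and> v = pt e (Suc k) \<or> v = pt e k \<and> u = pt e (Suc k)))"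

definition graph :: "nat pair_pre_digraph" where
  "graph = \<lparr>pverts = vs, parcs = {(u, v). adj u v}\<rparr>"

text \<open>The distance from \<open>v\<close> to hub \<open>i\<close>, cut off at \<open>r\<close>.\<close>

definition hub_dist :: "nat \<Rightarrow> nat \<Rightarrow> nat" where
  "hub_dist i v =
     (if r dvd v then if v = i * r then 0 else r
      else if i = src (v div r) then v mod r
      else if i = tgt (v div r) then r - v mod r else r)"

definition same_seg :: "nat \<Rightarrow> nat \<Rightarrow> bool" where
  "same_seg u v \<longleftrightarrow> \<not> r dvd u \<and> \<not> r dvd v \<and> u div r = v div r"

section \<open>Arithmetic of edges, hubs and path points; the order of the graph\<close>

lemma r_pos: "0 < r"
  using r_ge_2 by simp

lemma src_less: "e < 3 * r \<Longrightarrow> src e < 2 * r"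
  using r_pos by (auto simp: src_def)

lemma tgt_less: "e < 3 * r \<Longrightarrow> tgt e < 2 * r"
  using r_pos by (auto simp: tgt_def)

lemma src_ne_tgt: "e < 3 * r \<Longrightarrow> src e \<noteq> tgt e"
  using r_ge_2 by (auto simp: src_def tgt_def)

text \<open>The bound \<open>2 \<le> r\<close> rules out parallel edges: for \<open>r = 1\<close>
  all three edges would join the same two hubs. Hence a path is determined by its end hubs.\<close>

lemma edge_eq_if_ends_eq:
  assumes "e < 3 * r" "e' < 3 * r" "{src e, tgt e} = {src e', tgt e'}"
  shows "e = e'"
  using assms r_ge_2 by (auto simp: src_def tgt_def doubleton_eq_iff split: if_splits)

lemma card_vs: "card vs = r * (3 * r - 1)"
proof -
  have "card ((\<lambda>e. e * r) ` {2 * r..<3 * r}) = r"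
    using r_pos by (subst card_image) (auto simp: inj_on_def)
  moreover have "(\<lambda>e. e * r) ` {2 * r..<3 * r} \<subseteq> {..<3 * r * r}"
    using r_pos by auto
  ultimately show ?thesis
    unfolding vs_def by (subst card_Diff_subset) (auto simp: algebra_simps)
qed

lemma finite_vs: "finite vs"
  by (simp add: vs_def)

lemma hub_in_vs: "i * r \<in> vs \<longleftrightarrow> i < 2 * r"
  using r_pos by (auto simp: vs_def)

lemma vs_hubE:
  assumes "v \<in> vs" "r dvd v"
  obtains i where "i < 2 * r" "v = i * r"
proof -
  obtain i where "v = i * r" using assms(2) by (metis dvdE mult.commute)
  then show thesis using that assms(1) hub_in_vs by blast
qed

lemma vs_div_less: "v \<in> vs \<Longrightarrow> v div r < 3 * r"
  using r_pos by (auto simp: vs_def less_mult_imp_div_less)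

lemma pt_interior:
  assumes "0 < k" "k < r"
  shows "pt e k div r = e" "pt e k mod r = k" "\<not> r dvd pt e k"
  using assms by (auto simp: pt_def dvd_eq_mod_eq_0)

lemma pt_of_interior: "\<not> r dvd v \<Longrightarrow> pt (v div r) (v mod r) = v"
proof -
  assume "\<not> r dvd v"
  then have "v mod r \<noteq> 0" by (simp add: dvd_eq_mod_eq_0)
  moreover have "v mod r \<noteq> r" using r_pos mod_less_divisor[of r v] by linarith
  ultimately show ?thesis by (simp only: pt_def if_False div_mult_mod_eq)
qed

lemma pt_in_vs:
  assumes "e < 3 * r" "k \<le> r"
  shows "pt e k \<in> vs"
proof (cases "k = 0 \<or> k = r")
  case True
  then show ?thesis
    using src_less[OF assms(1)] tgt_less[OF assms(1)] r_pos by (auto simp: pt_def hub_in_vs)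
next
  case False
  then have k: "0 < k" "k < r" using assms by auto
  have "Suc e * r \<le> 3 * r * r"
    using assms(1) by (intro mult_right_mono) auto
  then have "pt e k < 3 * r * r"
    using k by (simp add: pt_def)
  moreover have "pt e k \<notin> (\<lambda>e. e * r) ` {2 * r..<3 * r}"
    using pt_interior(3)[OF k, of e] by auto
  ultimately show ?thesis by (simp add: vs_def)
qed

text \<open>At \<open>k = 0\<close> and \<open>k = r\<close> the cut-off at \<open>r\<close> agrees
  with the interior formula, so arguments along an arc need not treat hubs separately.\<close>

lemma hub_dist_pt:
  assumes "e < 3 * r" "k \<le> r"
  shows "hub_dist i (pt e k) = (if i = src e then k else if i = tgt e then r - k else r)"
proof -
  have hub: "hub_dist i (j * r) = (if i = j then 0 else r)" for j
    using r_pos by (auto simp: hub_dist_def)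
  consider "k = 0" | "k = r" | "0 < k" "k < r" using assms(2) by linarith
  then show ?thesis
  proof cases
    case 1
    then show ?thesis using hub[of "src e"] by (simp add: pt_def)
  next
    case 2
    then show ?thesis
      using hub[of "tgt e"] src_ne_tgt[OF assms(1)] r_pos by (simp add: pt_def)
  next
    case 3
    show ?thesis by (simp add: hub_dist_def pt_interior[OF 3])
  qed
qed

section \<open>Adjacency and the graph structure\<close>

lemma adj_sym: "adj u v \<Longrightarrow> adj v u"
  unfolding adj_def by blast

lemma adj_in_vs: "adj u v \<Longrightarrow> u \<in> vs \<and> v \<in> vs"
  unfolding adj_def by (auto intro!: pt_in_vs)

lemma adj_hub_dist: "adj u v \<Longrightarrow> hub_dist i v \<le> hub_dist i u + 1"
  unfolding adj_def by (auto simp: hub_dist_pt)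

lemma adj_same_seg:
  assumes "adj u v" "\<not> r dvd u" "\<not> r dvd v"
  shows "same_seg u v"
proof -
  obtain e k where ek: "e < 3 * r" "k < r"
    "u = pt e k \<and> v = pt e (Suc k) \<or> v = pt e k \<and> u = pt e (Suc k)"
    using assms(1) unfolding adj_def by blast
  have "r dvd pt e 0" "r dvd pt e r"
    by (simp_all add: pt_def)
  then have "k \<noteq> 0" "Suc k \<noteq> r"
    using ek assms(2,3) by metis+
  then show ?thesis
    using ek pt_interior[of k e] pt_interior[of "Suc k" e] by (auto simp: same_seg_def)
qed

lemma adj_irrefl: "\<not> adj v v"
proof
  assume "adj v v"
  then obtain e k where ek: "e < 3 * r" "k < r" "v = pt e k" "v = pt e (Suc k)"
    unfolding adj_def by blast
  then have "hub_dist (src e) (pt e k) = hub_dist (src e) (pt e (Suc k))" by simp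
  then show False using ek(1,2) by (simp add: hub_dist_pt)
qed

sublocale pair_graph graph
  rewrites "pverts graph = vs" and "parcs graph = {(u, v). adj u v}"
proof -
  have "finite {(u, v). adj u v}"
    by (rule finite_subset[of _ "vs \<times> vs"]) (auto simp: finite_vs dest: adj_in_vs)
  then show "pair_graph graph"
    by unfold_locales
      (auto simp: graph_def finite_vs symmetric_def sym_def adj_irrefl dest: adj_in_vs adj_sym)
qed (simp_all add: graph_def)

section \<open>Short walks and hub distances\<close>

lemma awalk_close:
  assumes "awalk u p v"
  shows "same_seg u v \<and> (\<forall>i. hub_dist i v \<le> hub_dist i u + length p) \<or>
    (\<exists>i<2 * r. hub_dist i u + hub_dist i v \<le> length p)"
  \<comment> \<open>A walk either stays in the interior of one path or visits some hub.\<close>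
  using assms
proof (induction p arbitrary: u)
  case Nil
  then have "u = v" "u \<in> vs" by (auto simp: awalk_Nil_iff)
  then show ?case
    by (cases "r dvd u") (auto simp: same_seg_def hub_dist_def elim!: vs_hubE)
next
  case (Cons a p)
  obtain w where a: "a = (u, w)" and uw: "adj u w" and walk: "awalk w p v"
    using Cons.prems by (cases a) (auto simp: awalk_Cons_iff)
  have step: "hub_dist i w \<le> hub_dist i u + 1" "hub_dist i u \<le> hub_dist i w + 1" for i
    using uw adj_sym adj_hub_dist by blast+
  from Cons.IH[OF walk] show ?case
  proof
    assume wv: "same_seg w v \<and> (\<forall>i. hub_dist i v \<le> hub_dist i w + length p)"
    have le: "hub_dist i v \<le> hub_dist i u + length (a # p)" for i
    proof -
      have "hub_dist i v \<le> hub_dist i w + length p" using wv by blast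
      then show ?thesis using step(1)[of i] by simp
    qed
    show ?thesis
    proof (cases "r dvd u")
      case True
      have "u \<in> vs" using adj_in_vs[OF uw] by blast
      from this True obtain i where "i < 2 * r" "u = i * r" by (rule vs_hubE)
      from \<open>u = i * r\<close> have "hub_dist i u = 0" by (simp add: hub_dist_def)
      then have "hub_dist i u + hub_dist i v \<le> length (a # p)" using le[of i] by simp
      with \<open>i < 2 * r\<close> show ?thesis by blast
    next
      case False
      then have "same_seg u v"
        using wv adj_same_seg[OF uw] by (auto simp: same_seg_def)
      then show ?thesis using le by blast
    qed
  next
    assume "\<exists>i<2 * r. hub_dist i w + hub_dist i v \<le> length p"
    then obtain i where "i < 2 * r" "hub_dist i w + hub_dist i v \<le> length p" by blast
    then show ?thesis using step(2)[of i] by (intro disjI2 exI[of _ i]) auto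
  qed
qed

text \<open>Serves as a necessary condition for two vertices to be equal or adjacent in the power
  with exponent \<open>r - 1\<close>.\<close>

definition close :: "nat \<Rightarrow> nat \<Rightarrow> bool" where
  "close u v \<longleftrightarrow> same_seg u v \<or> (\<exists>i<2 * r. hub_dist i u + hub_dist i v < r)"

lemma close_if_awalk: "awalk u p v \<Longrightarrow> length p < r \<Longrightarrow> close u v"
  using awalk_close unfolding close_def by (meson le_less_trans)

section \<open>Vertices near several hubs\<close>

text \<open>The two distances add up to \<open>r\<close> if the hubs are the ends of the path of
  \<open>v\<close>; otherwise at least one of them is \<open>r\<close>.\<close>

lemma hub_dist_add_ge:
  assumes "i \<noteq> j"
  shows "r \<le> hub_dist i v + hub_dist j v"
proof -
  have "v mod r < r" using r_pos by simp
  then show ?thesis using assms by (auto simp: hub_dist_def)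
qed

lemma hub_dist_less_iff:
  assumes "\<not> r dvd v"
  shows "hub_dist i v < r \<longleftrightarrow> i \<in> {src (v div r), tgt (v div r)}"
proof -
  have "v mod r < r" "0 < v mod r" using r_pos assms by (auto simp: dvd_eq_mod_eq_0)
  then show ?thesis using assms by (auto simp: hub_dist_def)
qed

lemma same_seg_hub_dist_less_iff:
  "same_seg u v \<Longrightarrow> hub_dist i u < r \<longleftrightarrow> hub_dist i v < r"
  by (auto simp: same_seg_def hub_dist_less_iff)

lemma interior_if_two_hubs:
  assumes "hub_dist i v < r" "hub_dist j v < r" "i \<noteq> j"
  shows "\<not> r dvd v"
  using assms r_pos by (auto simp: hub_dist_def split: if_splits)

text \<open>A vertex at distance below \<open>r\<close> from two hubs is interior to a path joining
  them, and the ladder has no parallel edges.\<close>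

lemma same_seg_if_two_hubs:
  assumes "u \<in> vs" "v \<in> vs" "i \<noteq> j"
    and "hub_dist i u < r" "hub_dist j u < r" "hub_dist i v < r" "hub_dist j v < r"
  shows "same_seg u v"
proof -
  have int: "\<not> r dvd u" "\<not> r dvd v"
    using assms interior_if_two_hubs by blast+
  have "{src (u div r), tgt (u div r)} = {src (v div r), tgt (v div r)}"
    using assms(3-7) hub_dist_less_iff[OF int(1)] hub_dist_less_iff[OF int(2)] by auto
  then show ?thesis
    using edge_eq_if_ends_eq vs_div_less assms(1,2) int by (auto simp: same_seg_def)
qed

lemma no_three_hubs:
  assumes "hub_dist i v < r" "hub_dist j v < r" "hub_dist k v < r" "i \<noteq> j" "j \<noteq> k"
  shows "i = k"
proof -
  note less_iff = hub_dist_less_iff[OF interior_if_two_hubs[OF assms(1,2,4)]]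
  from assms(1-3) have "{i, j, k} \<subseteq> {src (v div r), tgt (v div r)}"
    by (simp only: less_iff) blast
  then show ?thesis using assms(4,5) by auto
qed

section \<open>Cliques of the power and their hubs\<close>

lemma exists_not_same_seg:
  assumes "card S = r" "u \<in> S"
  shows "\<exists>v\<in>S. \<not> same_seg u v"
proof (rule ccontr)
  assume "\<not> ?thesis"
  then have same: "same_seg u v" if "v \<in> S" for v
    using that by blast
  have "S \<subseteq> (\<lambda>k. u div r * r + k) ` {1..<r}"
  proof
    fix v assume "v \<in> S"
    then have "same_seg u v" by (rule same)
    then have "u div r = v div r" "0 < v mod r" by (auto simp: same_seg_def dvd_eq_mod_eq_0)
    then have "v = u div r * r + v mod r" "v mod r \<in> {1..<r}"
      using r_pos by (auto simp: div_mult_mod_eq)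
    then show "v \<in> (\<lambda>k. u div r * r + k) ` {1..<r}" by (rule image_eqI)
  qed
  then have "card S \<le> card {1..<r}"
    by (rule surj_card_le[rotated]) simp
  then show False using assms(1) r_pos by simp
qed

text \<open>
  Three points on the paths of a triangle of hubs cannot be pairwise close, because the
  triangle has length \<open>3r\<close>.
\<close>

lemma no_clique_triangle:
  assumes vs: "x \<in> vs" "y \<in> vs" "u \<in> vs"
    and "close y u" "close x u"
    and "\<not> same_seg x y" "hub_dist i x + hub_dist i y < r"
    and "hub_dist j u < r" "i \<noteq> j" "\<not> hub_dist j y < r" "\<not> hub_dist i u < r"
  shows False
proof -
  have ixy: "hub_dist i x < r" "hub_dist i y < r" using assms(7) by auto
  have "\<not> same_seg y u" "\<not> same_seg x u"
    using same_seg_hub_dist_less_iff ixy assms(11) by blast+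
  then obtain k m where k: "hub_dist k y + hub_dist k u < r" and m: "hub_dist m x + hub_dist m u < r"
    using assms(4,5) unfolding close_def by blast
  then have less: "hub_dist k y < r" "hub_dist k u < r" "hub_dist m x < r" "hub_dist m u < r"
    by auto
  have "k \<noteq> i" "k \<noteq> j" "m \<noteq> i" using less assms(10,11) by auto
  have "m \<noteq> k"
    using same_seg_if_two_hubs[OF vs(1,2) \<open>k \<noteq> i\<close>] less ixy assms(6) by blast
  then have "m = j"
    using no_three_hubs[of m u j k] less assms(8) \<open>k \<noteq> j\<close> by blast
  \<comment> \<open>These six distances sum to at least \<open>3 * r\<close>; regrouped by hub,
    closeness of the three pairs makes the same sum smaller than \<open>3 * r\<close>.\<close>
  have "r \<le> hub_dist i x + hub_dist j x" "r \<le> hub_dist i y + hub_dist k y"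
    "r \<le> hub_dist j u + hub_dist k u"
    using \<open>i \<noteq> j\<close> \<open>k \<noteq> i\<close> \<open>k \<noteq> j\<close> by (simp_all add: hub_dist_add_ge)
  then show False
    using k m assms(7) unfolding \<open>m = j\<close> by linarith
qed

text \<open>All pairs share the one hub \<open>i\<close>; pairs interior to a common path are
  exempt, as they may be joined without visiting a hub.\<close>

definition clique_at :: "nat \<Rightarrow> nat set \<Rightarrow> bool" where
  "clique_at i S \<longleftrightarrow> S \<subseteq> vs \<and> card S = r \<and>
     (\<forall>u\<in>S. \<forall>v\<in>S. \<not> same_seg u v \<longrightarrow> hub_dist i u + hub_dist i v < r)"

text \<open>Some pair \<open>x\<close>, \<open>y\<close> of \<open>S\<close> is not interior to one
  path and supplies the hub \<open>i\<close>. A pair \<open>u\<close>, \<open>v\<close> failing at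
  \<open>i\<close> would be joined via another hub \<open>j\<close>, and then \<open>x\<close>,
  \<open>y\<close> and one of \<open>u\<close>, \<open>v\<close> form a forbidden triangle.\<close>

lemma exists_clique_at:
  assumes S: "S \<subseteq> vs" "card S = r" and close: "\<And>u v. u \<in> S \<Longrightarrow> v \<in> S \<Longrightarrow> close u v"
  shows "\<exists>i<2 * r. clique_at i S"
proof -
  from S(2) r_pos obtain x where x: "x \<in> S" by (metis card.empty ex_in_conv less_irrefl)
  then obtain y where y: "y \<in> S" and xy: "\<not> same_seg x y"
    using exists_not_same_seg S(2) by blast
  then obtain i where i: "i < 2 * r" "hub_dist i x + hub_dist i y < r"
    using close[OF x y] by (auto simp: close_def)
  have yx: "\<not> same_seg y x" "hub_dist i y + hub_dist i x < r"
    using xy i(2) by (auto simp: same_seg_def)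
  have "hub_dist i u + hub_dist i v < r" if u: "u \<in> S" and v: "v \<in> S" and uv: "\<not> same_seg u v" for u v
  proof (rule ccontr)
    assume no_i: "\<not> ?thesis"
    obtain j where j: "hub_dist j u + hub_dist j v < r"
      using close[OF u v] uv by (auto simp: close_def)
    then have "i \<noteq> j" using no_i by blast
    have less: "hub_dist i x < r" "hub_dist i y < r" "hub_dist j u < r" "hub_dist j v < r"
      using i j by auto
    have vs: "x \<in> vs" "y \<in> vs" "u \<in> vs" "v \<in> vs" using x y u v S(1) by auto
    \<comment> \<open>One of \<open>x\<close>, \<open>y\<close> is far from \<open>j\<close> and,
      likewise, one of \<open>u\<close>, \<open>v\<close> is far from \<open>i\<close>; the four
      triangle instances cover the choices.\<close>
    have "\<not> (hub_dist j x < r \<and> hub_dist j y < r)"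
      using same_seg_if_two_hubs[OF vs(1,2) \<open>i \<noteq> j\<close>] less xy by blast
    moreover have "\<not> (hub_dist i u < r \<and> hub_dist i v < r)"
      using same_seg_if_two_hubs[OF vs(3,4) \<open>i \<noteq> j\<close>] less uv by blast
    moreover note no_clique_triangle[OF vs(1,2,3) close close xy i(2) _ \<open>i \<noteq> j\<close>]
      no_clique_triangle[OF vs(1,2,4) close close xy i(2) _ \<open>i \<noteq> j\<close>]
      no_clique_triangle[OF vs(2,1,3) close close yx _ \<open>i \<noteq> j\<close>]
      no_clique_triangle[OF vs(2,1,4) close close yx _ \<open>i \<noteq> j\<close>]
    ultimately show False using x y u v less by blast
  qed
  then show ?thesis using i(1) S unfolding clique_at_def by blast
qed

lemma clique_at_hub_dist_less:
  assumes "clique_at i S" "u \<in> S"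
  shows "hub_dist i u < r"
proof -
  obtain v where "v \<in> S" "\<not> same_seg u v"
    using assms exists_not_same_seg unfolding clique_at_def by blast
  then have "hub_dist i u + hub_dist i v < r"
    using assms unfolding clique_at_def by blast
  then show ?thesis by simp
qed

section \<open>Counting the vertices of two cliques at one hub\<close>

text \<open>The inserted \<open>0\<close> is the depth on a path whose interior misses
  \<open>S\<close>.\<close>

definition depth :: "nat \<Rightarrow> nat set \<Rightarrow> nat \<Rightarrow> nat" where
  "depth i S e = Max (insert 0 (hub_dist i ` {v \<in> S. \<not> r dvd v \<and> v div r = e}))"

lemma depth_cases:
  assumes "finite S"
  obtains "depth i S e = 0"
  | v where "v \<in> S" "\<not> r dvd v" "v div r = e" "depth i S e = hub_dist i v"
proof -
  have "depth i S e \<in> insert 0 (hub_dist i ` {v \<in> S. \<not> r dvd v \<and> v div r = e})"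
    unfolding depth_def using assms by (intro Max_in) auto
  then show thesis using that by blast
qed

lemma hub_dist_le_depth:
  assumes "finite S" "v \<in> S" "\<not> r dvd v"
  shows "hub_dist i v \<le> depth i S (v div r)"
  unfolding depth_def using assms by (intro Max_ge) auto

lemma clique_at_finite: "clique_at i S \<Longrightarrow> finite S"
  using finite_vs finite_subset unfolding clique_at_def by blast

text \<open>The deepest vertices on two different paths are not interior to a common path, so the
  hub condition bounds the sum of their distances. If one depth is \<open>0\<close>, the other is
  below \<open>r\<close> anyway.\<close>

lemma depth_add_less:
  assumes S: "clique_at i S" and "e \<noteq> e'"
  shows "depth i S e + depth i S e' < r"
proof (cases rule: depth_cases[OF clique_at_finite[OF S], of i e])
  case 1
  show ?thesis
    by (cases rule: depth_cases[OF clique_at_finite[OF S], of i e'])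
      (use 1 r_pos clique_at_hub_dist_less[OF S] in auto)
next
  case (2 v)
  show ?thesis
  proof (cases rule: depth_cases[OF clique_at_finite[OF S], of i e'])
    case 1
    then show ?thesis using 2 clique_at_hub_dist_less[OF S] by auto
  next
    case (2 w)
    have "\<not> same_seg v w" using 2 \<open>v div r = e\<close> \<open>e \<noteq> e'\<close> by (auto simp: same_seg_def)
    then show ?thesis
      using S 2 \<open>v \<in> S\<close> \<open>depth i S e = _\<close> unfolding clique_at_def by auto
  qed
qed

lemma hub_edges:
  assumes "i < 2 * r"
  obtains a b c where "a \<noteq> b" "b \<noteq> c" "a \<noteq> c"
    "\<And>e. e < 3 * r \<Longrightarrow> i \<in> {src e, tgt e} \<Longrightarrow> e \<in> {a, b, c}"
proof
  \<comment> \<open>Edge \<open>i\<close> leaves the hub along the cycle, \<open>?b\<close> enters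
    it, and \<open>?c\<close> is its diagonal, which starts at the hub for \<open>i < r\<close> and
    ends there otherwise.\<close>
  let ?b = "if i = 0 then 2 * r - 1 else i - 1" and ?c = "if i < r then 2 * r + i else r + i"
  show "i \<noteq> ?b" "?b \<noteq> ?c" "i \<noteq> ?c"
    using assms r_ge_2 by (simp_all split: if_split) linarith+
  show "e \<in> {i, ?b, ?c}" if "e < 3 * r" "i \<in> {src e, tgt e}" for e
  proof (cases "e < 2 * r")
    case True
    then have "i = e \<or> i = 0 \<and> Suc e = 2 * r \<or> i = Suc e"
      using that(2) by (auto simp: src_def tgt_def split: if_splits)
    then have "e = i \<or> e = ?b" by (elim disjE conjE) auto
    then show ?thesis by blast
  next
    case False
    then have "i = e - 2 * r \<or> i = e - r"
      using that(2) by (simp add: src_def tgt_def)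
    moreover have "e - 2 * r < r" "\<not> e - r < r" "2 * r + (e - 2 * r) = e" "r + (e - r) = e"
      using False that(1) by linarith+
    ultimately have "e = ?c" by metis
    then show ?thesis by blast
  qed
qed

text \<open>On the interior of a path ending at hub \<open>i\<close>, the distances to
  \<open>i\<close> are distinct and positive. The bound \<open>hub_dist i v < r\<close> makes the
  set empty if \<open>i\<close> is no end of path \<open>e\<close>, where the cut-off gives every
  vertex the same distance.\<close>

lemma card_initial_seg:
  "finite {v. \<not> r dvd v \<and> v div r = e \<and> hub_dist i v \<le> d \<and> hub_dist i v < r} \<and>
   card {v. \<not> r dvd v \<and> v div r = e \<and> hub_dist i v \<le> d \<and> hub_dist i v < r} \<le> d" (is "finite ?A \<and> _")
proof -
  have inj: "inj_on (hub_dist i) ?A"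
  proof (rule inj_onI)
    fix u v assume uv: "u \<in> ?A" "v \<in> ?A" "hub_dist i u = hub_dist i v"
    have "hub_dist i w = (if i = src e then w mod r else r - w mod r)" if "w \<in> ?A" for w
    proof -
      have w: "\<not> r dvd w" "w div r = e" "hub_dist i w < r" using that by blast+
      show ?thesis using w(1,3) unfolding hub_dist_def w(2) by (simp split: if_splits)
    qed
    from this[OF uv(1)] this[OF uv(2)]
    have "(if i = src e then u mod r else r - u mod r) = (if i = src e then v mod r else r - v mod r)"
      using uv(3) by (simp only:)
    moreover have "u mod r \<le> r" "v mod r \<le> r" using r_pos by (simp_all add: less_imp_le)
    ultimately have "u mod r = v mod r"
      by (simp only: eq_diff_iff split: if_splits)
    moreover from uv(1,2) have "u div r = e" "v div r = e" by blast+
    ultimately show "u = v" by (metis div_mult_mod_eq)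
  qed
  have "0 < hub_dist i v" if "\<not> r dvd v" for v
  proof -
    have "v mod r < r" "0 < v mod r" using r_pos that by (auto simp: dvd_eq_mod_eq_0)
    then show ?thesis using that by (auto simp: hub_dist_def)
  qed
  then have sub: "hub_dist i ` ?A \<subseteq> {1..d}"
    by (auto simp: Suc_le_eq)
  show ?thesis
    using card_inj_on_le[OF inj sub] inj_on_finite[OF inj sub] by simp
qed

lemma cliques_at_hub_intersect:
  assumes i: "i < 2 * r" and S: "clique_at i S" and T: "clique_at i T"
  shows "S \<inter> T \<noteq> {}"
proof
  assume disj: "S \<inter> T = {}"
  obtain a b c where ne: "a \<noteq> b" "b \<noteq> c" "a \<noteq> c"
    and abc: "\<And>e. e < 3 * r \<Longrightarrow> i \<in> {src e, tgt e} \<Longrightarrow> e \<in> {a, b, c}"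
    using hub_edges[OF i] by metis
  define d where "d e = max (depth i S e) (depth i T e)" for e
  define A where "A e = {v. \<not> r dvd v \<and> v div r = e \<and> hub_dist i v \<le> d e \<and> hub_dist i v < r}" for e
  have A: "finite (A e)" "card (A e) \<le> d e" for e
    using card_initial_seg unfolding A_def by blast+
  have "v \<in> insert (i * r) (A a \<union> A b \<union> A c)" if "v \<in> S \<union> T" for v
  proof (cases "r dvd v")
    case True
    have "hub_dist i v < r"
      using that clique_at_hub_dist_less S T by blast
    then show ?thesis using True by (auto simp: hub_dist_def split: if_splits)
  next
    case False
    have less: "hub_dist i v < r"
      using that clique_at_hub_dist_less S T by blast
    have "v \<in> vs" using that S T unfolding clique_at_def by blast
    then have "v div r \<in> {a, b, c}"
      using abc vs_div_less less hub_dist_less_iff[OF False] by blast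
    moreover have "hub_dist i v \<le> d (v div r)"
      using that False hub_dist_le_depth clique_at_finite[OF S] clique_at_finite[OF T]
      unfolding d_def by (metis Un_iff max.coboundedI1 max.coboundedI2)
    ultimately show ?thesis using False less unfolding A_def by auto
  qed
  then have "card (S \<union> T) \<le> card (insert (i * r) (A a \<union> A b \<union> A c))"
    using A(1) by (intro card_mono) auto
  also have "\<dots> \<le> Suc (card (A a \<union> A b \<union> A c))"
    using A(1) by (simp add: card_insert_if)
  also have "\<dots> \<le> Suc (d a + d b + d c)"
    using card_Un_le[of "A a \<union> A b" "A c"] card_Un_le[of "A a" "A b"] A(2)[of a] A(2)[of b] A(2)[of c]
    by linarith
  \<comment> \<open>By pigeonhole two of the three maxima come from the same clique, so they add up
    to at most \<open>r - 1\<close>; the third is at most \<open>r - 1\<close> as well.\<close>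
  also have "\<dots> < 2 * r"
    using depth_add_less[OF S ne(1)] depth_add_less[OF S ne(2)] depth_add_less[OF S ne(3)]
      depth_add_less[OF T ne(1)] depth_add_less[OF T ne(2)] depth_add_less[OF T ne(3)]
    unfolding d_def max_def by (auto split: if_splits)
  finally have "card (S \<union> T) < 2 * r" .
  moreover have "card (S \<union> T) = 2 * r"
    using S T disj clique_at_finite[OF S] clique_at_finite[OF T]
    by (subst card_Un_disjoint) (auto simp: clique_at_def)
  ultimately show False by simp
qed

section \<open>The power has no complete factor\<close>

lemma no_complete_factor: "\<not> is_complete_factor r H (graph_power graph (r - 1))"
proof
  assume H: "is_complete_factor r H (graph_power graph (r - 1))"
  then interpret H: pair_graph H
    by (simp add: is_complete_factor_def)
  let ?C = "H.sccs_verts"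
  have pvH: "pverts H = vs" and arcs: "parcs H \<subseteq> parcs (graph_power graph (r - 1))"
    using H by (auto simp: is_complete_factor_def spanning_def subgraph_def graph_power_def graph_def)
  have clique: "\<exists>i<2 * r. clique_at i S" if S: "S \<in> ?C" for S
  proof -
    obtain C where C: "C \<in> H.sccs" "verts C = S"
      using S H.sccs_verts_conv by auto
    then have K: "complete_digraph r C"
      using H by (simp add: is_complete_factor_def)
    then have card: "card S = r" and ends: "arcs_ends C = {(u, v). (u, v) \<in> S \<times> S \<and> u \<noteq> v}"
      using C(2) by (simp_all add: complete_digraph_def)
    have sub: "S \<subseteq> vs"
      using H.sccs_verts_subsets[OF S] pvH by simp
    have "close u v" if uv: "u \<in> S" "v \<in> S" for u v
    proof (cases "u = v")
      case True
      \<comment> \<open>\<open>exists_clique_at\<close> asks for closeness of equal vertices too,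
        and \<open>same_seg\<close> fails for a hub and itself; the empty walk handles this.\<close>
      then have "awalk u [] v" using uv sub by (auto simp: awalk_Nil_iff)
      then show ?thesis by (rule close_if_awalk) (simp add: r_pos)
    next
      case False
      then have "(u, v) \<in> arcs_ends C" using ends uv by simp
      moreover have "subgraph C (with_proj H)"
        using C(1) by (blast intro: induced_imp_subgraph)
      then have "arcs_ends C \<subseteq> parcs H"
        using arcs_ends_mono[of C "with_proj H"] by simp
      ultimately have "(u, v) \<in> parcs H" by blast
      then obtain p where p: "apath u p v" "length p \<le> r - 1"
        using arcs unfolding graph_power_def by auto
      then have "awalk u p v" by (simp add: apath_def)
      moreover have "length p < r" using p(2) r_pos by linarith
      ultimately show ?thesis by (rule close_if_awalk)
    qed
    then show ?thesis using exists_clique_at[OF sub card] by blast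
  qed
  \<comment> \<open>Distinct components are disjoint, while two cliques at one hub meet. Choosing a
    hub for each component is therefore an injection into the \<open>2 * r\<close> hubs.\<close>
  then obtain h where h: "h S < 2 * r" "clique_at (h S) S" if "S \<in> ?C" for S
    by metis
  have "inj_on h ?C"
  proof (rule inj_onI)
    fix S T assume ST: "S \<in> ?C" "T \<in> ?C" "h S = h T"
    then have "S \<inter> T \<noteq> {}"
      using cliques_at_hub_intersect h by metis
    then show "S = T"
      using H.sccs_verts_disjoint ST by blast
  qed
  moreover have "h ` ?C \<subseteq> {..<2 * r}" using h(1) by auto
  ultimately have few: "card ?C \<le> 2 * r"
    using card_inj_on_le[of h ?C "{..<2 * r}"] by simp
  have Un: "\<Union> ?C = vs"
    using H.sccs_verts_subsets H.scc_of_in_sccs_verts H.in_scc_of_self pvH by blast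
  \<comment> \<open>The components partition the vertices into blocks of size \<open>r\<close>, so
    the order forces \<open>3 * r - 1\<close> blocks, more than \<open>2 * r\<close>.\<close>
  have "r * card ?C = card (\<Union> ?C)"
    using H.finite_sccs_verts finite_vs h(2) H.sccs_verts_disjoint
    by (intro card_partition) (auto simp: Un clique_at_def)
  also have "\<dots> = r * (3 * r - 1)" by (simp add: Un card_vs)
  finally have "card ?C = 3 * r - 1" using r_pos by simp
  then show False using few r_ge_2 by simp
qed

section \<open>Connectedness after deleting one vertex\<close>

text \<open>Following decreasing \<open>rank\<close> leads from every vertex to \<open>a\<close>.
  This spares explicit walks: each vertex only has to exhibit one suitable neighbour.\<close>

lemma connected_induced_if_rank:
  fixes rank :: "nat \<Rightarrow> nat"
  assumes W: "W \<subseteq> vs" "a \<in> W"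
    and step: "\<And>v. v \<in> W \<Longrightarrow> v \<noteq> a \<Longrightarrow> \<exists>w\<in>W. adj v w \<and> rank w < rank v"
  shows "connected (with_proj graph \<restriction> W)"
proof -
  let ?M = "mk_symmetric (with_proj graph \<restriction> W)"
  have parcs: "parcs ?M = {(u, v). adj u v \<and> u \<in> W \<and> v \<in> W}"
    by (auto simp: parcs_mk_symmetric induce_subgraph_def adj_sym graph_def)
  have to_a: "(v, a) \<in> rtrancl_on W (parcs ?M) \<and> (a, v) \<in> rtrancl_on W (parcs ?M)" if "v \<in> W" for v
    using that
  proof (induction "rank v" arbitrary: v rule: less_induct)
    case less
    show ?case
    proof (cases "v = a")
      case False
      then obtain w where w: "w \<in> W" "adj v w" "rank w < rank v"
        using step less.prems by blast
      then have "(v, w) \<in> parcs ?M" "(w, v) \<in> parcs ?M"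
        using less.prems adj_sym by (auto simp: parcs)
      then show ?thesis
        using less.hyps[OF w(3,1)] less.prems
        by (meson converse_rtrancl_on_into_rtrancl_on rtrancl_on_into_rtrancl_on)
    qed (use W in auto)
  qed
  show ?thesis
    unfolding connected_def strongly_connected_def reachable_def
    using to_a W(2) by (auto intro: rtrancl_on_trans)
qed

lemma adj_cycle:
  assumes "v < 2 * r * r"
  shows "adj v (if Suc v = 2 * r * r then 0 else Suc v)"
proof -
  define e k where "e = v div r" and "k = v mod r"
  have v: "v = e * r + k" "k < r" and e: "e < 2 * r"
    using assms r_pos by (auto simp: e_def k_def less_mult_imp_div_less)
  have pt_k: "pt e k = v"
    using v e by (simp add: pt_def src_def)
  have "pt e (Suc k) = (if Suc v = 2 * r * r then 0 else Suc v)"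
  proof (cases "Suc k = r")
    case True
    then have "Suc v = Suc e * r" using v by simp
    moreover from this have "Suc v = 2 * r * r \<longleftrightarrow> Suc e = 2 * r"
      using r_pos by (simp only: mult_cancel2) simp
    moreover have "pt e r = tgt e * r" using r_pos by (simp add: pt_def)
    ultimately show ?thesis
      using True e by (simp only: tgt_def if_True split: if_split) simp
  next
    case False
    then have "\<not> r dvd Suc v"
      using v by (simp add: dvd_eq_mod_eq_0)
    then have "Suc v \<noteq> 2 * r * r" by auto
    then show ?thesis
      using False v by (simp add: pt_def)
  qed
  then show ?thesis
    using pt_k e v(2) unfolding adj_def by (intro exI[of _ e] exI[of _ k]) auto
qed

lemma adj_cycle_pred: "0 < v \<Longrightarrow> v < 2 * r * r \<Longrightarrow> adj v (v - 1)"
  using adj_cycle[of "v - 1"] adj_sym by (auto split: if_splits)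

lemma cycle_in_vs: "v < 2 * r * r \<Longrightarrow> v \<in> vs"
  using adj_cycle adj_in_vs by blast

lemma chord_interior:
  assumes "v \<in> vs" "\<not> v < 2 * r * r"
  shows "\<not> r dvd v" "2 * r \<le> v div r"
proof -
  show "\<not> r dvd v"
    using assms vs_hubE r_pos by (metis mult_less_cancel2)
  show "2 * r \<le> v div r"
    using assms r_pos by (simp add: less_eq_div_iff_mult_less_eq)
qed

text \<open>A vertex off the cycle moves along its diagonal to an end without meeting
  \<open>x\<close>; from there the route runs backwards around the cycle to
  \<open>a\<close>.\<close>

lemma connected_remove: "connected (with_proj graph \<restriction> (vs - {x}))"
proof -
  define M where "M = 2 * r * r"
  \<comment> \<open>If \<open>x\<close> is on the cycle, \<open>a\<close> is its cyclic successor,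
    so going backwards reaches \<open>a\<close> before \<open>x\<close>; otherwise \<open>0\<close>
    is an arbitrary choice.\<close>
  define a where "a = (if x < M \<and> Suc x \<noteq> M then Suc x else 0)"
  \<comment> \<open>On a diagonal, \<open>up\<close> says that the way to the cycle avoiding \<open>x\<close> leads to the target end.\<close>
  define up where "up v \<longleftrightarrow> src (v div r) * r = x \<or> v div r = x div r \<and> x < v" for v
  \<comment> \<open>Adding \<open>M\<close> up to \<open>x\<close> makes the rank increase all the
    way round from \<open>a\<close> to the predecessor of \<open>x\<close>. The offset
    \<open>2 * M\<close> puts diagonals above the cycle, and the last summand counts the steps left
    to the chosen end.\<close>
  define rank where "rank v =
    (if v < M then if x < M \<and> v \<le> x then v + M else v
     else 2 * M + (if up v then r - v mod r else v mod r))" for v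
  have M: "1 < M" using r_ge_2 mult_le_mono[OF r_ge_2 r_ge_2] by (simp add: M_def)
  show ?thesis
  proof (rule connected_induced_if_rank[where a = a and rank = rank])
    show "vs - {x} \<subseteq> vs" by blast
    have "a < M" "a \<noteq> x" using M by (auto simp: a_def)
    then show "a \<in> vs - {x}" using cycle_in_vs by (auto simp: M_def)
    fix v assume v: "v \<in> vs - {x}" and "v \<noteq> a"
    show "\<exists>w\<in>vs - {x}. adj v w \<and> rank w < rank v"
    proof (cases "v < M")
      case True
      define w where "w = (if v = 0 then M - 1 else v - 1)"
      have "adj v w"
      proof (cases "v = 0")
        case True
        have "adj (M - 1) 0" using adj_cycle[of "M - 1", folded M_def] M by simp
        then show ?thesis using True by (simp add: w_def adj_sym)
      next
        case False
        then show ?thesis using \<open>v < M\<close> adj_cycle_pred[of v] by (simp add: w_def M_def)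
      qed
      moreover have "w \<noteq> x"
        using v \<open>v \<noteq> a\<close> True M by (auto simp: w_def a_def split: if_splits)
      moreover have "rank w < rank v"
        using v \<open>v \<noteq> a\<close> True M \<open>w \<noteq> x\<close> by (auto simp: w_def a_def rank_def split: if_splits)
      ultimately show ?thesis using adj_in_vs by blast
    next
      case False
      define e k where "e = v div r" and "k = v mod r"
      have int: "\<not> r dvd v" and e: "2 * r \<le> e" "e < 3 * r"
        using chord_interior v vs_div_less False unfolding M_def e_def by auto
      have k: "0 < k" "k < r" using int r_pos by (auto simp: k_def dvd_eq_mod_eq_0)
      have v_pt: "v = pt e k" using pt_of_interior[OF int] by (simp add: e_def k_def)
      define j where "j = (if up v then Suc k else k - 1)"
      have "adj v (pt e j)"
      proof (cases "up v")
        case False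
        then have "j = k - 1" "Suc (k - 1) = k" using k by (auto simp: j_def)
        then show ?thesis
          using e k v_pt unfolding adj_def
          by (metis less_imp_diff_less)
      qed (use e k v_pt in \<open>auto simp: j_def adj_def\<close>)
      moreover have "pt e j \<noteq> x \<and> rank (pt e j) < rank v"
      proof (cases "0 < j \<and> j < r")
        case True
        then have w: "pt e j div r = e" "pt e j mod r = j" by (simp_all add: pt_interior)
        then have up_w: "up (pt e j) \<longleftrightarrow> src e * r = x \<or> e = x div r \<and> x < pt e j"
          by (simp add: up_def)
        have w_eq: "pt e j = e * r + j" and v_eq: "v = e * r + k"
          using True k v_pt by (simp_all add: pt_def)
        have "M \<le> e * r" using e(1) by (simp add: M_def)
        then have not_cycle: "\<not> pt e j < M" "\<not> v < M" by (simp_all add: w_eq v_eq)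
        show ?thesis
        proof (cases "up v")
          case up: True
          \<comment> \<open>Going up leaves \<open>x\<close> behind: it is the source hub, which
            lies below \<open>M\<close>, or it is smaller than \<open>v\<close>.\<close>
          then have "src e * r = x \<or> e = x div r \<and> x < v" by (simp add: up_def e_def)
          moreover have "src e * r < M"
            using src_less[OF e(2)] r_pos by (simp add: M_def)
          moreover have "pt e j = Suc v"
            using w_eq v_eq up unfolding j_def by simp
          ultimately have "pt e j \<noteq> x" "up (pt e j)"
            using not_cycle up_w by auto
          then show ?thesis
            using up k not_cycle w by (simp add: rank_def j_def flip: k_def)
        next
          case up: False
          then have "src e * r \<noteq> x" "\<not> (e = x div r \<and> x < v)" by (simp_all add: up_def e_def)
          moreover have less: "pt e j < v"
            using w_eq v_eq up k unfolding j_def by simp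
          \<comment> \<open>If the next vertex down were \<open>x\<close>, then \<open>x\<close>
            would have the same quotient as \<open>v\<close> and be smaller, so \<open>up v\<close>
            would hold.\<close>
          ultimately have "pt e j \<noteq> x" "\<not> up (pt e j)"
            using w up_w by auto
          then show ?thesis
            using up k not_cycle w by (simp add: rank_def j_def flip: k_def)
        qed
      next
        case False
        then have hub: "pt e j = (if up v then tgt e * r else src e * r)"
          using k r_pos by (auto simp: j_def pt_def)
        have "pt e j < M"
          using src_less[OF e(2)] tgt_less[OF e(2)] r_pos by (simp add: hub M_def)
        moreover have "pt e j \<noteq> x"
        proof (cases "up v")
          case True
          \<comment> \<open>The target hub satisfies neither alternative: it differs from the source
            hub and its quotient is below \<open>2 * r\<close>.\<close>
          then have "src e * r = x \<or> 2 * r \<le> x div r" using e(1) by (auto simp: up_def e_def)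
          then show ?thesis
            using True hub src_ne_tgt[OF e(2)] tgt_less[OF e(2)] r_pos by auto
        next
          case False
          then have "pt e j = src e * r" using hub by simp
          then show ?thesis using False by (simp add: up_def e_def)
        qed
        ultimately show ?thesis
          using \<open>\<not> v < M\<close> k by (simp add: rank_def flip: k_def)
      qed
      ultimately show ?thesis using adj_in_vs by blast
    qed
  qed
qed

lemma two_connected: "k_connected 2 graph"
  unfolding k_connected_def
proof (intro conjI allI impI)
  have "2 * 5 \<le> r * (3 * r - 1)"
    using r_ge_2 by (intro mult_le_mono) auto
  then show "2 < card (pverts graph)" by (simp add: card_vs graph_def)
  fix X assume "X \<subseteq> pverts graph \<and> card X < 2"
  then have "X \<subseteq> vs" "card X = 0 \<or> card X = 1"
    by (auto simp: graph_def)
  then have X: "finite X" "card X = 0 \<or> card X = 1"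
    using finite_subset[OF _ finite_vs] by blast+
  have "\<exists>x. vs - X = vs - {x}"
  proof (cases "card X = 0")
    case True
    \<comment> \<open>Deleting nothing is treated as deleting the non-vertex
      \<open>3 * r * r\<close>.\<close>
    have "3 * r * r \<notin> vs" by (simp add: vs_def)
    then show ?thesis using True X by (intro exI[of _ "3 * r * r"]) auto
  next
    case False
    then show ?thesis using X(2) by (auto simp: card_1_singleton_iff)
  qed
  then show "connected (with_proj graph \<restriction> (pverts graph - X))"
    using connected_remove by (auto simp: graph_def)
qed

end

theorem mainTheorem5:
  fixes r :: nat
  assumes "r \<ge> 2"
  shows "\<exists>G :: nat pair_pre_digraph.
           pair_graph G \<and> k_connected 2 G \<and> r dvd card (pverts G) \<and>
           \<not> (\<exists>H. is_complete_factor r H (graph_power G (r - 1)))"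
proof -
  interpret subdivided_moebius_ladder r
    using assms by unfold_locales
  have "r dvd card (pverts graph)"
    by (simp add: graph_def card_vs)
  then show ?thesis
    using pair_graph two_connected no_complete_factor by blast
qed

end
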